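(* Let $G$ be a countable sofic group, $\Sigma$ a sofic approximation sequence for $G$, and $\pi:(X,G)\to(Y,G)$ a factor map between $G$-systems with $\mathrm{mdim}_\Sigma(Y|X)\ge0$. If the smallest closed $G$-invariant equivalence relation on $Y$ containing $\mathrm D_2^{\mathrm{md}}(Y|X,G,\Sigma)$ is $Y\times Y$, then $\pi$ has sofic $Y|X$-CPMD.
   Context: For $d\in\mathbb N$ write $[d]=\{1,\dots,d\}$ and $\mathrm{Sym}(d)$ for the permutation group of $[d]$. A sofic approximation sequence for a countable group $G$ is a sequence of maps (not necessarily homomorphisms) $\Sigma=\{\sigma_i:G\to\mathrm{Sym}(d_i)\}_{i\ge1}$ such that $\frac1{d_i}|\{v\in[d_i]:\sigma_i(s)\sigma_i(t)(v)=\sigma_i(st)(v)\}|\to1$ for all $s,t\in G$, $\frac1{d_i}|\{v\in[d_i]:\sigma_i(s)(v)=\sigma_i(t)(v)\}|\to0$ for all distinct $s,t\in G$, and $d_i\to\infty$; $G$ is sofic if one exists. A $G$-system $(X,G)$ is a compact metric space $X$ with a continuous action of $G$ by homeomorphisms. A factor map $\pi:(X,G)\to(Y,G)$ is a continuous surjection with $\pi(gx)=g\pi(x)$. $\mathcal F(G)$ is the collection of nonempty finite subsets of $G$. For a compatible metric $\rho$ on $X$, $F\in\mathcal F(G)$, $\delta>0$ and a map $\sigma:G\to\mathrm{Sym}(d)$, $\mathrm{Map}(\rho,F,\delta,\sigma)\subset X^d$ is the set of maps $\xi:[d]\to X$ with $\big(\frac1d\sum_{a\in[d]}\rho(\xi(\sigma(s)(a)),s\,\xi(a))^2\big)^{1/2}\le\delta$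 for all $s\in F$. Let $\pi^d:X^d\to Y^d$, $\xi\mapsto\pi\circ\xi$. For a finite open cover $\beta$ of a space $K$, $\mathrm{ord}(\beta)=\max_{x\in K}\sum_{U\in\beta}1_U(x)-1$, and $D(\beta)$ is the minimum of $\mathrm{ord}(\gamma)$ over finite open covers $\gamma$ of $K$ refining $\beta$ (every member of $\gamma$ is contained in a member of $\beta$); both are $-\infty$ if $K=\emptyset$. For a finite open cover $\alpha$ of $Y$, $\alpha^d$ is the cover of $Y^d$ by the sets $U_1\times\cdots\times U_d$, $U_j\in\alpha$, and $D(\pi,\alpha,\rho,F,\delta,\sigma)=D(\alpha^d|_{\pi^d(\mathrm{Map}(\rho,F,\delta,\sigma))})$. Let $$\mathrm{mdim}_\Sigma(\pi,\alpha)=\inf_{F\in\mathcal F(G)}\inf_{\delta>0}\limsup_{i\to\infty}\frac{D(\pi,\alpha,\rho,F,\delta,\sigma_i)}{d_i},\qquad\mathrm{mdim}_\Sigma(Y|X)=\sup_\alpha\mathrm{mdim}_\Sigma(\pi,\alpha),$$ the supremum over finite open covers $\alpha$ of $Y$; the limsup is $-\infty$ if $\mathrm{Map}(\rho,F,\delta,\sigma_i)=\emptyset$ for all large $i$. These values do not depend on the compatible metric $\rho$ on $X$. For a factor map $\phi:(Y,G)\to(Z,G)$, $\mathrm{mdim}_\Sigma(Z|X)$ is computed with respect to $\phi\circ\pi:(X,G)\to(Z,G)$. Let $\Delta_2(Y)=\{(y,y):y\in Y\}$. For $(y_1,y_2)\in Y^2\setminus\Delta_2(Y)$, a finite open cover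 $\alpha$ of $Y$ is admissible with respect to $(y_1,y_2)$ if $\{y_1,y_2\}\not\subset\overline U$ for every $U\in\alpha$. $\mathrm D_2^{\mathrm{md}}(Y|X,G,\Sigma)$ is the set of $(y_1,y_2)\in Y^2\setminus\Delta_2(Y)$ such that $\mathrm{mdim}_\Sigma(\pi,\alpha)>0$ for every admissible $\alpha$ with respect to $(y_1,y_2)$. $\pi$ has sofic $Y|X$-CPMD (relative completely positive sofic mean dimension relevant to $X$) if $\mathrm{mdim}_\Sigma(Z|X)>0$ for every proper factor $(Z,G)$ of $(Y,G)$, where "proper" means that $Z$ is not a single point. *)

theory Defs
  imports "HOL-Analysis.Analysis" "HOL-Algebra.Group_Action"
begin

section \<open>Sofic approximation sequences\<close>

text \<open>A group element acts on \<open>[d] = {1..d}\<close> by a permutation of the naturals supported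
  there. The sequence is indexed from 0, which does not affect any of the limits.\<close>

definition sofic_approximation ::
    "('g, 'm) monoid_scheme \<Rightarrow> (nat \<Rightarrow> nat) \<Rightarrow> (nat \<Rightarrow> 'g \<Rightarrow> nat \<Rightarrow> nat) \<Rightarrow> bool" where
  "sofic_approximation G d \<sigma> \<longleftrightarrow>
     (\<forall>i. \<forall>s\<in>carrier G. \<sigma> i s permutes {1..d i}) \<and>
     (\<forall>s\<in>carrier G. \<forall>t\<in>carrier G.
        (\<lambda>i. real (card {v \<in> {1..d i}. \<sigma> i s (\<sigma> i t v) = \<sigma> i (s \<otimes>\<^bsub>G\<^esub> t) v}) / real (d i))
          \<longlonglongrightarrow> 1) \<and>
     (\<forall>s\<in>carrier G. \<forall>t\<in>carrier G. s \<noteq> t \<longrightarrow>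
        (\<lambda>i. real (card {v \<in> {1..d i}. \<sigma> i s v = \<sigma> i t v}) / real (d i)) \<longlonglongrightarrow> 0) \<and>
     filterlim d at_top sequentially"

definition sofic_group :: "('g, 'm) monoid_scheme \<Rightarrow> bool" where
  "sofic_group G \<longleftrightarrow> group G \<and> (\<exists>d \<sigma>. sofic_approximation G d \<sigma>)"


section \<open>Systems and factor maps\<close>

record ('g, 'x) gsys =
  pts :: "'x set"
  metric :: "'x \<Rightarrow> 'x \<Rightarrow> real"
  act :: "'g \<Rightarrow> 'x \<Rightarrow> 'x"

abbreviation sys_top :: "('g, 'x) gsys \<Rightarrow> 'x topology" where
  "sys_top S \<equiv> Metric_space.mtopology (pts S) (metric S)"

text \<open>The library's \<^const>\<open>group_action\<close> asks each \<open>act S g\<close> to be extensional, i.e. fixes its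
  irrelevant values outside \<open>pts S\<close>.\<close>

definition G_system :: "('g, 'm) monoid_scheme \<Rightarrow> ('g, 'x) gsys \<Rightarrow> bool" where
  "G_system G S \<longleftrightarrow>
     Metric_space (pts S) (metric S) \<and>
     compact_space (sys_top S) \<and>
     group_action G (pts S) (act S) \<and>
     (\<forall>g\<in>carrier G. homeomorphic_map (sys_top S) (sys_top S) (act S g))"

definition factor_map ::
    "('g, 'm) monoid_scheme \<Rightarrow> ('g, 'x) gsys \<Rightarrow> ('g, 'y) gsys \<Rightarrow> ('x \<Rightarrow> 'y) \<Rightarrow> bool" where
  "factor_map G S T \<pi> \<longleftrightarrow>
     continuous_map (sys_top S) (sys_top T) \<pi> \<and>
     \<pi> ` pts S = pts T \<and>
     (\<forall>g\<in>carrier G. \<forall>x\<in>pts S. \<pi> (act S g x) = act T g (\<pi> x))"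


section \<open>Covers\<close>

definition finite_open_cover :: "'a topology \<Rightarrow> 'a set set \<Rightarrow> bool" where
  "finite_open_cover K \<beta> \<longleftrightarrow>
     finite \<beta> \<and> (\<forall>U\<in>\<beta>. openin K U) \<and> \<Union>\<beta> = topspace K"

text \<open>The supremum of the empty set of extended reals is \<open>-\<infinity>\<close>, so both quantities below are
  \<open>-\<infinity>\<close> on the empty space. For a finite open cover both extrema are attained, as the values
  of \<open>cover_ord\<close> are natural numbers otherwise.\<close>

definition cover_ord :: "'a topology \<Rightarrow> 'a set set \<Rightarrow> ereal" where
  "cover_ord K \<beta> = (SUP x\<in>topspace K. ereal (real (card {U \<in> \<beta>. x \<in> U}) - 1))"

definition cover_D :: "'a topology \<Rightarrow> 'a set set \<Rightarrow> ereal" where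
  "cover_D K \<beta> =
     (INF \<gamma>\<in>{\<gamma>. finite_open_cover K \<gamma> \<and> (\<forall>V\<in>\<gamma>. \<exists>U\<in>\<beta>. V \<subseteq> U)}. cover_ord K \<gamma>)"

definition power_cover :: "nat \<Rightarrow> 'a set set \<Rightarrow> (nat \<Rightarrow> 'a) set set" where
  "power_cover d \<alpha> = {PiE {1..d} U | U. U \<in> {1..d} \<rightarrow>\<^sub>E \<alpha>}"


section \<open>Relative sofic mean dimension\<close>

definition Map_space ::
    "('g, 'x) gsys \<Rightarrow> 'g set \<Rightarrow> real \<Rightarrow> nat \<Rightarrow> ('g \<Rightarrow> nat \<Rightarrow> nat) \<Rightarrow> (nat \<Rightarrow> 'x) set" where
  "Map_space S F \<delta> d \<sigma> =
     {\<xi> \<in> {1..d} \<rightarrow>\<^sub>E pts S. \<forall>s\<in>F.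
        sqrt (1 / real d * (\<Sum>a\<in>{1..d}. (metric S (\<xi> (\<sigma> s a)) (act S s (\<xi> a)))\<^sup>2)) \<le> \<delta>}"

definition D_map ::
    "('g, 'x) gsys \<Rightarrow> ('g, 'y) gsys \<Rightarrow> ('x \<Rightarrow> 'y) \<Rightarrow> 'y set set \<Rightarrow>
     'g set \<Rightarrow> real \<Rightarrow> nat \<Rightarrow> ('g \<Rightarrow> nat \<Rightarrow> nat) \<Rightarrow> ereal" where
  "D_map S T \<pi> \<alpha> F \<delta> d \<sigma> =
     (let K = compose {1..d} \<pi> ` Map_space S F \<delta> d \<sigma>
      in cover_D (subtopology (product_topology (\<lambda>_. sys_top T) {1..d}) K)
           ((\<lambda>U. U \<inter> K) ` power_cover d \<alpha>))"

text \<open>The metric on the source is the one carried by the system \<open>S\<close>; the value depends only on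
  the topology it induces.\<close>

definition mdim_cover ::
    "('g, 'm) monoid_scheme \<Rightarrow> (nat \<Rightarrow> nat) \<Rightarrow> (nat \<Rightarrow> 'g \<Rightarrow> nat \<Rightarrow> nat) \<Rightarrow>
     ('g, 'x) gsys \<Rightarrow> ('g, 'y) gsys \<Rightarrow> ('x \<Rightarrow> 'y) \<Rightarrow> 'y set set \<Rightarrow> ereal" where
  "mdim_cover G d \<sigma> S T \<pi> \<alpha> =
     (INF F\<in>{F. F \<subseteq> carrier G \<and> finite F \<and> F \<noteq> {}}. INF \<delta>\<in>{0<..}.
        limsup (\<lambda>i. D_map S T \<pi> \<alpha> F \<delta> (d i) (\<sigma> i) / ereal (real (d i))))"

definition mdim_rel ::
    "('g, 'm) monoid_scheme \<Rightarrow> (nat \<Rightarrow> nat) \<Rightarrow> (nat \<Rightarrow> 'g \<Rightarrow> nat \<Rightarrow> nat) \<Rightarrow>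
     ('g, 'x) gsys \<Rightarrow> ('g, 'y) gsys \<Rightarrow> ('x \<Rightarrow> 'y) \<Rightarrow> ereal" where
  "mdim_rel G d \<sigma> S T \<pi> =
     (SUP \<alpha>\<in>{\<alpha>. finite_open_cover (sys_top T) \<alpha>}. mdim_cover G d \<sigma> S T \<pi> \<alpha>)"


section \<open>Mean dimension pairs and completely positive mean dimension\<close>

definition admissible_cover :: "'y topology \<Rightarrow> 'y \<Rightarrow> 'y \<Rightarrow> 'y set set \<Rightarrow> bool" where
  "admissible_cover K y1 y2 \<alpha> \<longleftrightarrow>
     finite_open_cover K \<alpha> \<and> (\<forall>U\<in>\<alpha>. \<not> {y1, y2} \<subseteq> K closure_of U)"

definition D2_md ::
    "('g, 'm) monoid_scheme \<Rightarrow> (nat \<Rightarrow> nat) \<Rightarrow> (nat \<Rightarrow> 'g \<Rightarrow> nat \<Rightarrow> nat) \<Rightarrow>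
     ('g, 'x) gsys \<Rightarrow> ('g, 'y) gsys \<Rightarrow> ('x \<Rightarrow> 'y) \<Rightarrow> ('y \<times> 'y) set" where
  "D2_md G d \<sigma> S T \<pi> =
     {(y1, y2). y1 \<in> pts T \<and> y2 \<in> pts T \<and> y1 \<noteq> y2 \<and>
        (\<forall>\<alpha>. admissible_cover (sys_top T) y1 y2 \<alpha> \<longrightarrow> 0 < mdim_cover G d \<sigma> S T \<pi> \<alpha>)}"

definition closed_invariant_equiv ::
    "('g, 'm) monoid_scheme \<Rightarrow> ('g, 'y) gsys \<Rightarrow> ('y \<times> 'y) set \<Rightarrow> bool" where
  "closed_invariant_equiv G T R \<longleftrightarrow>
     equiv (pts T) R \<and>
     closedin (prod_topology (sys_top T) (sys_top T)) R \<and>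
     (\<forall>g\<in>carrier G. \<forall>(y1, y2)\<in>R. (act T g y1, act T g y2) \<in> R)"

definition closed_invariant_equiv_gen ::
    "('g, 'm) monoid_scheme \<Rightarrow> ('g, 'y) gsys \<Rightarrow> ('y \<times> 'y) set \<Rightarrow> ('y \<times> 'y) set" where
  "closed_invariant_equiv_gen G T A = \<Inter>{R. closed_invariant_equiv G T R \<and> A \<subseteq> R}"

text \<open>HOL cannot quantify over types inside a definition, so the type \<open>'z\<close> of points of the
  factors is a parameter; a theorem concluding this for a type variable \<open>'z\<close> covers factors
  living on any type.\<close>

definition sofic_CPMD ::
    "'z itself \<Rightarrow> ('g, 'm) monoid_scheme \<Rightarrow> (nat \<Rightarrow> nat) \<Rightarrow> (nat \<Rightarrow> 'g \<Rightarrow> nat \<Rightarrow> nat) \<Rightarrow>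
     ('g, 'x) gsys \<Rightarrow> ('g, 'y) gsys \<Rightarrow> ('x \<Rightarrow> 'y) \<Rightarrow> bool" where
  "sofic_CPMD _ G d \<sigma> S T \<pi> \<longleftrightarrow>
     (\<forall>(Z :: ('g, 'z) gsys) \<phi>.
        G_system G Z \<and> factor_map G T Z \<phi> \<and> \<not> (\<exists>z. pts Z = {z}) \<longrightarrow>
        0 < mdim_rel G d \<sigma> S Z (\<phi> \<circ> \<pi>))"

end

theory Submission
  imports Defs
begin

text \<open>Let \<open>\<phi> : Y \<rightarrow> Z\<close> be a factor map onto a system that is not a single point. Its fibre relation
  \<open>{(y, y'). \<phi> y = \<phi> y'}\<close> is a closed invariant equivalence relation on \<open>Y\<close>, and it is not all of
  \<open>Y \<times> Y\<close>, because \<open>Z\<close> has two points: \<open>Z\<close> could otherwise only be empty, and then so would be \<open>X\<close>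
  and every \<open>Map_space\<close>, which makes the mean dimension of \<open>Y\<close> relative to \<open>X\<close> equal to \<open>-\<infinity>\<close>. As
  the mean dimension pairs generate \<open>Y \<times> Y\<close>, some pair \<open>(y1, y2)\<close> among them is separated by \<open>\<phi>\<close>.

  Being admissible is preserved by pulling back covers along continuous maps, so a cover \<open>\<beta>\<close> of
  \<open>Z\<close> that is admissible for \<open>(\<phi> y1, \<phi> y2)\<close> pulls back to one that is admissible for \<open>(y1, y2)\<close>;
  the latter has positive mean dimension by the choice of the pair. Finally a pulled back cover
  has at most the mean dimension of the original one (\<open>mdim_cover_pullback_le\<close>): refinements of
  the power of \<open>\<beta>\<close> on the image of \<open>Map_space\<close> in the power of \<open>Z\<close> pull back to refinements on
  its image in the power of \<open>Y\<close>, and pulling back never increases the order.\<close>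

definition pullback_cover :: "'a topology \<Rightarrow> ('a \<Rightarrow> 'b) \<Rightarrow> 'b set set \<Rightarrow> 'a set set" where
  "pullback_cover K f \<beta> = (\<lambda>U. {x \<in> topspace K. f x \<in> U}) ` \<beta>"


section \<open>Pulling back covers along continuous maps\<close>

lemma finite_open_cover_pullback:
  assumes f: "continuous_map K L f" and \<beta>: "finite_open_cover L \<beta>"
  shows "finite_open_cover K (pullback_cover K f \<beta>)"
proof -
  have "openin K {x \<in> topspace K. f x \<in> U}" if "U \<in> \<beta>" for U
    using that \<beta> f by (auto simp: finite_open_cover_def intro: openin_continuous_map_preimage)
  moreover have "f x \<in> \<Union>\<beta>" if "x \<in> topspace K" for x
    using that \<beta> f by (auto simp: finite_open_cover_def continuous_map_def)
  ultimately show ?thesis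
    using \<beta> unfolding finite_open_cover_def pullback_cover_def by (fastforce dest: openin_subset)
qed

text \<open>Distinct members of the pulled back cover that contain \<open>x\<close> come from distinct members of the
  original one that contain \<open>f x\<close>.\<close>

lemma cover_ord_pullback_le:
  assumes f: "continuous_map K L f" and fin: "finite \<gamma>"
  shows "cover_ord K (pullback_cover K f \<gamma>) \<le> cover_ord L \<gamma>"
  unfolding cover_ord_def
proof (rule SUP_mono)
  fix x assume x: "x \<in> topspace K"
  have "{W \<in> pullback_cover K f \<gamma>. x \<in> W}
      \<subseteq> (\<lambda>U. {x \<in> topspace K. f x \<in> U}) ` {U \<in> \<gamma>. f x \<in> U}"
    by (auto simp: pullback_cover_def)
  then have "card {W \<in> pullback_cover K f \<gamma>. x \<in> W} \<le> card {U \<in> \<gamma>. f x \<in> U}"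
    using fin by (intro surj_card_le) auto
  moreover have "f x \<in> topspace L"
    using f x by (auto simp: continuous_map_def)
  ultimately show "\<exists>y\<in>topspace L. ereal (real (card {W \<in> pullback_cover K f \<gamma>. x \<in> W}) - 1)
      \<le> ereal (real (card {U \<in> \<gamma>. y \<in> U}) - 1)"
    by auto
qed

text \<open>A refinement of \<open>\<beta>\<close> on \<open>L\<close> pulls back to a refinement of \<open>\<beta>'\<close> on \<open>K\<close> of no larger order, so
  the infimum over \<open>K\<close> is taken over at least as good a supply of covers. Asking only that
  preimages of members of \<open>\<beta>\<close> lie in members of \<open>\<beta>'\<close> leaves \<open>\<beta>'\<close> free to be the power of a
  pulled back cover rather than the pullback of a power.\<close>

lemma cover_D_le_of_continuous_map:
  assumes f: "continuous_map K L f"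
    and refine: "\<And>U. U \<in> \<beta> \<Longrightarrow> \<exists>U'\<in>\<beta>'. {x \<in> topspace K. f x \<in> U} \<subseteq> U'"
  shows "cover_D K \<beta>' \<le> cover_D L \<beta>"
  unfolding cover_D_def
proof (rule INF_mono)
  fix \<gamma> assume "\<gamma> \<in> {\<gamma>. finite_open_cover L \<gamma> \<and> (\<forall>V\<in>\<gamma>. \<exists>U\<in>\<beta>. V \<subseteq> U)}"
  then have \<gamma>: "finite_open_cover L \<gamma>" and sub: "\<And>V. V \<in> \<gamma> \<Longrightarrow> \<exists>U\<in>\<beta>. V \<subseteq> U"
    by auto
  have "\<exists>U'\<in>\<beta>'. W \<subseteq> U'" if W: "W \<in> pullback_cover K f \<gamma>" for W
  proof -
    obtain V where V: "V \<in> \<gamma>" "W = {x \<in> topspace K. f x \<in> V}"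
      using W by (auto simp: pullback_cover_def)
    obtain U where U: "U \<in> \<beta>" "V \<subseteq> U"
      using sub V(1) by blast
    obtain U' where "U' \<in> \<beta>'" "{x \<in> topspace K. f x \<in> U} \<subseteq> U'"
      using refine U(1) by blast
    then show ?thesis
      using U V by blast
  qed
  moreover have "cover_ord K (pullback_cover K f \<gamma>) \<le> cover_ord L \<gamma>"
    using f \<gamma> by (intro cover_ord_pullback_le) (auto simp: finite_open_cover_def)
  ultimately show "\<exists>\<gamma>'\<in>{\<gamma>. finite_open_cover K \<gamma> \<and> (\<forall>V\<in>\<gamma>. \<exists>U\<in>\<beta>'. V \<subseteq> U)}.
      cover_ord K \<gamma>' \<le> cover_ord L \<gamma>"
    using finite_open_cover_pullback[OF f \<gamma>] by blast
qed

text \<open>The closure of a preimage lies in the preimage of the closure, so a pulled back set can touch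
  both points only if the original set touches both images.\<close>

lemma admissible_cover_pullback:
  assumes f: "continuous_map K L f" and adm: "admissible_cover L (f y1) (f y2) \<beta>"
  shows "admissible_cover K y1 y2 (pullback_cover K f \<beta>)"
  unfolding admissible_cover_def
proof (intro conjI ballI)
  show "finite_open_cover K (pullback_cover K f \<beta>)"
    using finite_open_cover_pullback[OF f] adm by (auto simp: admissible_cover_def)
  fix W assume "W \<in> pullback_cover K f \<beta>"
  then obtain U where U: "U \<in> \<beta>" "W = {x \<in> topspace K. f x \<in> U}"
    by (auto simp: pullback_cover_def)
  have "f ` (K closure_of W) \<subseteq> L closure_of (f ` W)"
    using f by (simp add: continuous_map_image_closure_subset)
  also have "\<dots> \<subseteq> L closure_of U"
    using U(2) by (intro closure_of_mono) auto
  finally have "f ` (K closure_of W) \<subseteq> L closure_of U" .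
  then show "\<not> {y1, y2} \<subseteq> K closure_of W"
    using adm U(1) by (auto simp: admissible_cover_def)
qed

text \<open>The complements of disjoint closed neighbourhoods of the two points form an admissible cover.\<close>

lemma admissible_cover_exists:
  assumes "Metric_space M \<rho>" and "z1 \<in> M" "z2 \<in> M" "z1 \<noteq> z2"
  shows "\<exists>\<beta>. admissible_cover (Metric_space.mtopology M \<rho>) z1 z2 \<beta>"
proof -
  interpret Metric_space M \<rho> by fact
  define r where "r = \<rho> z1 z2 / 4"
  define U where "U z = M - mcball z r" for z
  have r: "r > 0"
    using assms by (simp add: r_def)
  have "z \<notin> mtopology closure_of U z" if "z \<in> M" for z
  proof -
    have "mball z r \<inter> U z = {}"
      using mball_subset_mcball by (auto simp: U_def)
    then have "mball z r \<inter> mtopology closure_of U z = {}"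
      by (simp add: openin_Int_closure_of_eq_empty)
    then show ?thesis
      using r that by auto
  qed
  moreover have "mcball z1 r \<inter> mcball z2 r = {}"
  proof -
    have False if z: "z \<in> M" "\<rho> z1 z \<le> r" "\<rho> z2 z \<le> r" for z
      using triangle[of z1 z z2] z assms(2-) commute[of z2 z] r unfolding r_def by linarith
    then show ?thesis
      by auto
  qed
  moreover have "openin mtopology (U z)" for z
    using openin_diff[OF openin_topspace closedin_mcball] by (simp add: U_def)
  ultimately have "admissible_cover mtopology z1 z2 {U z1, U z2}"
    using assms by (auto simp: admissible_cover_def finite_open_cover_def U_def)
  then show ?thesis ..
qed


section \<open>Mean dimension of a pulled back cover\<close>

text \<open>The power map \<open>\<phi>\<^sup>d\<close> carries \<open>\<pi>\<^sup>d(Map)\<close> into \<open>(\<phi> \<circ> \<pi>)\<^sup>d(Map)\<close>, and the power of the pulled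
  back cover consists of the preimages of the boxes in the power of \<open>\<beta>\<close>.\<close>

lemma D_map_pullback_le:
  assumes \<phi>: "continuous_map (sys_top Y) (sys_top Z) \<phi>"
    and \<pi>: "\<pi> ` pts X \<subseteq> topspace (sys_top Y)"
  shows "D_map X Y \<pi> (pullback_cover (sys_top Y) \<phi> \<beta>) F \<delta> n s
       \<le> D_map X Z (\<phi> \<circ> \<pi>) \<beta> F \<delta> n s"
proof -
  let ?I = "{1..n}"
  define M where "M = Map_space X F \<delta> n s"
  define K where "K = compose ?I \<pi> ` M"
  define L where "L = compose ?I (\<phi> \<circ> \<pi>) ` M"
  let ?PY = "product_topology (\<lambda>_. sys_top Y) ?I"
  let ?PZ = "product_topology (\<lambda>_. sys_top Z) ?I"
  let ?f = "compose ?I \<phi>"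
  have image: "?f ` K = L"
    by (auto simp: K_def L_def image_image compose_def fun_eq_iff intro!: image_cong)
  have "M \<subseteq> ?I \<rightarrow>\<^sub>E pts X"
    by (auto simp: M_def Map_space_def)
  then have K: "K \<subseteq> ?I \<rightarrow>\<^sub>E topspace (sys_top Y)"
    unfolding K_def PiE_def using \<pi>
    by (intro image_subsetI IntI compose_extensional funcset_compose[of _ _ "pts X"]) auto
  have "continuous_map ?PY ?PZ ?f"
    unfolding continuous_map_componentwise
  proof (intro conjI ballI)
    show "?f ` topspace ?PY \<subseteq> extensional ?I"
      by auto
    fix k assume k: "k \<in> ?I"
    have "continuous_map ?PY (sys_top Z) (\<phi> \<circ> (\<lambda>x. x k))"
      using k by (intro continuous_map_compose[OF _ \<phi>] continuous_map_product_projection)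
    then show "continuous_map ?PY (sys_top Z) (\<lambda>x. ?f x k)"
      using k by (simp add: compose_def o_def)
  qed
  then have f: "continuous_map (subtopology ?PY K) (subtopology ?PZ L) ?f"
    using image by (auto simp: continuous_map_in_subtopology
        intro: continuous_map_from_subtopology)
  have "cover_D (subtopology ?PY K)
          ((\<lambda>U. U \<inter> K) ` power_cover n (pullback_cover (sys_top Y) \<phi> \<beta>))
      \<le> cover_D (subtopology ?PZ L) ((\<lambda>U. U \<inter> L) ` power_cover n \<beta>)"
  proof (rule cover_D_le_of_continuous_map[OF f])
    fix W assume "W \<in> (\<lambda>U. U \<inter> L) ` power_cover n \<beta>"
    then obtain U where U: "U \<in> ?I \<rightarrow>\<^sub>E \<beta>" "W = PiE ?I U \<inter> L"
      by (auto simp: power_cover_def)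
    define V where "V = (\<lambda>i\<in>?I. {y \<in> topspace (sys_top Y). \<phi> y \<in> U i})"
    have "V \<in> ?I \<rightarrow>\<^sub>E pullback_cover (sys_top Y) \<phi> \<beta>"
      using U(1) by (auto simp: V_def pullback_cover_def)
    then have "PiE ?I V \<inter> K
        \<in> (\<lambda>U. U \<inter> K) ` power_cover n (pullback_cover (sys_top Y) \<phi> \<beta>)"
      by (auto simp: power_cover_def)
    moreover have "{x \<in> topspace (subtopology ?PY K). ?f x \<in> W} \<subseteq> PiE ?I V \<inter> K"
    proof
      fix x assume x: "x \<in> {x \<in> topspace (subtopology ?PY K). ?f x \<in> W}"
      then have "x \<in> K" "?f x \<in> PiE ?I U"
        using U(2) by auto
      moreover from this have "x \<in> ?I \<rightarrow>\<^sub>E topspace (sys_top Y)"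
        using K by blast
      ultimately show "x \<in> PiE ?I V \<inter> K"
        by (simp add: V_def PiE_iff compose_eq)
    qed
    ultimately show "\<exists>U'\<in>(\<lambda>U. U \<inter> K) ` power_cover n (pullback_cover (sys_top Y) \<phi> \<beta>).
        {x \<in> topspace (subtopology ?PY K). ?f x \<in> W} \<subseteq> U'"
      by blast
  qed
  then show ?thesis
    by (simp add: D_map_def Let_def K_def L_def M_def)
qed

lemma mdim_cover_pullback_le:
  assumes d: "filterlim d at_top sequentially"
    and \<phi>: "continuous_map (sys_top Y) (sys_top Z) \<phi>"
    and \<pi>: "\<pi> ` pts X \<subseteq> topspace (sys_top Y)"
  shows "mdim_cover G d \<sigma> X Y \<pi> (pullback_cover (sys_top Y) \<phi> \<beta>)
       \<le> mdim_cover G d \<sigma> X Z (\<phi> \<circ> \<pi>) \<beta>"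
proof -
  have "\<forall>\<^sub>F i in sequentially. 0 < d i"
    using eventually_compose_filterlim[OF eventually_gt_at_top d] .
  then show ?thesis
    unfolding mdim_cover_def
    by (intro INF_mono' Limsup_mono)
      (auto elim!: eventually_mono intro!: ereal_divide_right_mono D_map_pullback_le[OF \<phi> \<pi>])
qed

text \<open>With no points in \<open>X\<close> there is no map from a nonempty \<open>[d]\<close> into it, so the empty family is a
  cover of the image of \<open>Map_space\<close>, of order \<open>-\<infinity>\<close>. The set \<open>F\<close> in the infimum has to be nonempty,
  hence the hypothesis on \<open>G\<close>.\<close>

lemma mdim_cover_empty:
  assumes d: "filterlim d at_top sequentially" and G: "carrier G \<noteq> {}" and X: "pts X = {}"
  shows "mdim_cover G d \<sigma> X Y \<pi> \<alpha> = -\<infinity>"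
proof -
  obtain g where g: "g \<in> carrier G"
    using G by auto
  have D: "D_map X Y \<pi> \<alpha> {g} 1 n s = -\<infinity>" if "n > 0" for n s
  proof -
    have "{1..n} \<rightarrow>\<^sub>E pts X = {}"
      using X that by (subst PiE_eq_empty_iff) auto
    then have "Map_space X {g} 1 n s = {}"
      unfolding Map_space_def by blast
    then have "D_map X Y \<pi> \<alpha> {g} 1 n s \<le> cover_ord (subtopology
        (product_topology (\<lambda>_. sys_top Y) {1..n}) {}) {}"
      unfolding D_map_def Let_def cover_D_def by (intro INF_lower2[of "{}"])
        (simp_all add: finite_open_cover_def)
    then show ?thesis
      by (simp add: cover_ord_def bot_ereal_def)
  qed
  have "\<forall>\<^sub>F i in sequentially. 0 < d i"
    using eventually_compose_filterlim[OF eventually_gt_at_top d] .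
  then have "\<forall>\<^sub>F i in sequentially. D_map X Y \<pi> \<alpha> {g} 1 (d i) (\<sigma> i) / ereal (real (d i)) = -\<infinity>"
    by (rule eventually_mono) (simp only: D, simp)
  then have "limsup (\<lambda>i. D_map X Y \<pi> \<alpha> {g} 1 (d i) (\<sigma> i) / ereal (real (d i))) = -\<infinity>"
    by (subst Limsup_eq[where g = "\<lambda>_. -\<infinity>"]) (auto simp: Limsup_const)
  moreover have "mdim_cover G d \<sigma> X Y \<pi> \<alpha>
      \<le> limsup (\<lambda>i. D_map X Y \<pi> \<alpha> {g} 1 (d i) (\<sigma> i) / ereal (real (d i)))"
    unfolding mdim_cover_def using g by (intro INF_lower2[of "{g}"] INF_lower) auto
  ultimately show ?thesis
    by simp
qed


section \<open>Completely positive mean dimension\<close>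

text \<open>Closedness is where the Hausdorff property of \<open>Z\<close> enters: the relation is the equalizer of the
  two continuous maps \<open>\<phi> \<circ> fst\<close> and \<open>\<phi> \<circ> snd\<close>.\<close>

lemma closed_invariant_equiv_fibre_relation:
  assumes Y: "G_system G Y" and Z: "G_system G Z" and \<phi>: "factor_map G Y Z \<phi>"
  shows "closed_invariant_equiv G Y {(y, y') \<in> pts Y \<times> pts Y. \<phi> y = \<phi> y'}"
    (is "closed_invariant_equiv G Y ?R")
proof -
  interpret Y: Metric_space "pts Y" "metric Y"
    using Y by (simp add: G_system_def)
  interpret Z: Metric_space "pts Z" "metric Z"
    using Z by (simp add: G_system_def)
  interpret group_action G "pts Y" "act Y"
    using Y by (simp add: G_system_def)
  have cont: "continuous_map (sys_top Y) (sys_top Z) \<phi>"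
    and equivariant: "\<And>g y. g \<in> carrier G \<Longrightarrow> y \<in> pts Y \<Longrightarrow> \<phi> (act Y g y) = act Z g (\<phi> y)"
    using \<phi> by (auto simp: factor_map_def)
  let ?P = "prod_topology (sys_top Y) (sys_top Y)"
  have "closedin ?P {p \<in> topspace ?P. (\<phi> \<circ> fst) p = (\<phi> \<circ> snd) p}"
    by (rule closedin_continuous_maps_eq[OF Z.Hausdorff_space_mtopology
          continuous_map_compose[OF continuous_map_fst cont]
          continuous_map_compose[OF continuous_map_snd cont]])
  moreover have "{p \<in> topspace ?P. (\<phi> \<circ> fst) p = (\<phi> \<circ> snd) p} = ?R"
    by auto
  ultimately have "closedin ?P ?R"
    by simp
  moreover have "equiv (pts Y) ?R"
    by (auto intro!: equivI refl_onI symI transI)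
  moreover have "(act Y g y, act Y g y') \<in> ?R" if "g \<in> carrier G" "(y, y') \<in> ?R" for g y y'
    using that element_image by (auto simp: equivariant)
  ultimately show ?thesis
    unfolding closed_invariant_equiv_def by blast
qed

theorem theorem6p14:
  fixes G :: "('g, 'm) monoid_scheme"
    and d :: "nat \<Rightarrow> nat" and \<sigma> :: "nat \<Rightarrow> 'g \<Rightarrow> nat \<Rightarrow> nat"
    and X :: "('g, 'x) gsys" and Y :: "('g, 'y) gsys" and \<pi> :: "'x \<Rightarrow> 'y"
  assumes "group G" and "countable (carrier G)" and "sofic_group G"
    and "sofic_approximation G d \<sigma>"
    and "G_system G X" and "G_system G Y" and "factor_map G X Y \<pi>"
    and "mdim_rel G d \<sigma> X Y \<pi> \<ge> 0"
    and "closed_invariant_equiv_gen G Y (D2_md G d \<sigma> X Y \<pi>) = pts Y \<times> pts Y"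
  shows "sofic_CPMD TYPE('z) G d \<sigma> X Y \<pi>"
  unfolding sofic_CPMD_def
proof (intro allI impI, elim conjE)
  fix Z :: "('g, 'z) gsys" and \<phi>
  assume Z: "G_system G Z" and \<phi>: "factor_map G Y Z \<phi>" and proper: "\<not> (\<exists>z. pts Z = {z})"
  interpret Y: Metric_space "pts Y" "metric Y"
    using assms(6) by (simp add: G_system_def)
  have metric_Z: "Metric_space (pts Z) (metric Z)"
    using Z by (simp add: G_system_def)
  have d: "filterlim d at_top sequentially"
    using assms(4) by (simp add: sofic_approximation_def)
  have cont: "continuous_map (sys_top Y) (sys_top Z) \<phi>" and onto: "\<phi> ` pts Y = pts Z"
    using \<phi> by (auto simp: factor_map_def)
  have \<pi>: "\<pi> ` pts X = pts Y"
    using assms(7) by (simp add: factor_map_def)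
  have "pts X \<noteq> {}"
  proof
    assume "pts X = {}"
    moreover have "carrier G \<noteq> {}"
      using group.is_monoid[OF assms(1)] monoid.carrier_not_empty by blast
    ultimately have "mdim_rel G d \<sigma> X Y \<pi> \<le> -\<infinity>"
      unfolding mdim_rel_def by (intro SUP_least) (simp add: mdim_cover_empty[OF d])
    then show False
      using assms(8) by simp
  qed
  then have "pts Z \<noteq> {}"
    using \<pi> onto by auto
  then obtain z z' where "z \<in> pts Z" "z' \<in> pts Z" "z \<noteq> z'"
    using proper by blast
  then obtain y y' where "y \<in> pts Y" "y' \<in> pts Y" "\<phi> y \<noteq> \<phi> y'"
    unfolding onto[symmetric] by blast
  then have not_all: "{(y, y') \<in> pts Y \<times> pts Y. \<phi> y = \<phi> y'} \<noteq> pts Y \<times> pts Y"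
    by blast
  have "\<not> D2_md G d \<sigma> X Y \<pi> \<subseteq> {(y, y') \<in> pts Y \<times> pts Y. \<phi> y = \<phi> y'}"
  proof
    assume "D2_md G d \<sigma> X Y \<pi> \<subseteq> {(y, y') \<in> pts Y \<times> pts Y. \<phi> y = \<phi> y'}"
    then have "pts Y \<times> pts Y \<subseteq> {(y, y') \<in> pts Y \<times> pts Y. \<phi> y = \<phi> y'}"
      using closed_invariant_equiv_fibre_relation[OF assms(6) Z \<phi>]
      unfolding assms(9)[symmetric] closed_invariant_equiv_gen_def by (intro Inter_lower) simp
    then show False
      using not_all by blast
  qed
  then obtain y1 y2 where pair: "(y1, y2) \<in> D2_md G d \<sigma> X Y \<pi>"
    and y: "y1 \<in> pts Y" "y2 \<in> pts Y" "\<phi> y1 \<noteq> \<phi> y2"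
    by (auto simp: D2_md_def)
  obtain \<beta> where \<beta>: "admissible_cover (sys_top Z) (\<phi> y1) (\<phi> y2) \<beta>"
    using admissible_cover_exists[OF metric_Z] y onto by blast
  have "0 < mdim_cover G d \<sigma> X Y \<pi> (pullback_cover (sys_top Y) \<phi> \<beta>)"
    using pair admissible_cover_pullback[OF cont \<beta>] by (auto simp: D2_md_def)
  also have "\<dots> \<le> mdim_cover G d \<sigma> X Z (\<phi> \<circ> \<pi>) \<beta>"
    using \<pi> by (intro mdim_cover_pullback_le[OF d cont]) simp
  also have "\<dots> \<le> mdim_rel G d \<sigma> X Z (\<phi> \<circ> \<pi>)"
    using \<beta> unfolding mdim_rel_def by (intro SUP_upper) (simp add: admissible_cover_def)
  finally show "0 < mdim_rel G d \<sigma> X Z (\<phi> \<circ> \<pi>)" .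
qed

end
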